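(* Let $A$ be a separable unital C*-algebra, and let $\alpha \colon G \to \mathrm{Aut}(A)$ be an action of a finite group $G$ on $A$. Then $\alpha$ has the Rokhlin property if and only if for every finite set $F \subset A$ and every $\varepsilon > 0$, there are mutually orthogonal projections $e_g \in A$ for $g \in G$ such that: (1) $\alpha_g(e_h) = e_{gh}$ for all $g, h \in G$. (2) $\|e_g a - a e_g\| < \varepsilon$ for all $g \in G$ and all $a \in F$. (3) $\sum_{g \in G} e_g = 1$.
   Context: Rokhlin property: an action $\alpha \colon G \to \mathrm{Aut}(A)$ of a finite group $G$ on a separable unital C*-algebra $A$ has the Rokhlin property if for every finite set $F \subset A$ and every $\varepsilon > 0$, there are mutually orthogonal projections $e_g \in A$ for $g \in G$ such that: $\|\alpha_g(e_h) - e_{gh}\| < \varepsilon$ for all $g, h \in G$; $\|e_g a - a e_g\| < \varepsilon$ for all $g \in G$ and all $a \in F$; and $\sum_{g \in G} e_g = 1$. *)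

theory Defs
  imports "HOL-Analysis.Analysis" "HOL-Algebra.Group"
begin

text \<open>
  Unital complex C*-algebras. The real normed space and norm completeness come from \<^class>\<open>banach\<close>;
  the complex scalar multiplication extends the real one. The class \<^class>\<open>monoid_mult\<close> is used
  instead of \<^class>\<open>ring_1\<close> so that \<open>0 \<noteq> 1\<close> is not imposed and the zero algebra is included.
\<close>

class unital_cstar_algebra = banach + real_normed_algebra + monoid_mult +
  fixes scaleC :: "complex \<Rightarrow> 'a \<Rightarrow> 'a"
    and adj :: "'a \<Rightarrow> 'a"
  assumes scaleC_add_right: "scaleC c (x + y) = scaleC c x + scaleC c y"
    and scaleC_add_left: "scaleC (c + d) x = scaleC c x + scaleC d x"
    and scaleC_scaleC: "scaleC c (scaleC d x) = scaleC (c * d) x"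
    and scaleC_of_real: "scaleC (complex_of_real r) x = scaleR r x"
    and norm_scaleC: "norm (scaleC c x) = cmod c * norm x"
    and mult_scaleC_left: "scaleC c x * y = scaleC c (x * y)"
    and mult_scaleC_right: "x * scaleC c y = scaleC c (x * y)"
    and adj_adj: "adj (adj x) = x"
    and adj_add: "adj (x + y) = adj x + adj y"
    and adj_scaleC: "adj (scaleC c x) = scaleC (cnj c) (adj x)"
    and adj_mult: "adj (x * y) = adj y * adj x"
    and cstar_identity: "norm (adj x * x) = (norm x)\<^sup>2"

definition star_automorphism :: "('a::unital_cstar_algebra \<Rightarrow> 'a) \<Rightarrow> bool" where
  "star_automorphism f \<longleftrightarrow>
     bij f \<and>
     (\<forall>x y. f (x + y) = f x + f y) \<and>
     (\<forall>c x. f (scaleC c x) = scaleC c (f x)) \<and>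
     (\<forall>x y. f (x * y) = f x * f y) \<and>
     (\<forall>x. f (adj x) = adj (f x))"

definition Aut_cstar :: "('a::unital_cstar_algebra \<Rightarrow> 'a) monoid" where
  "Aut_cstar = \<lparr>carrier = {f. star_automorphism f}, mult = (\<circ>), one = id\<rparr>"

lemma star_automorphism_inv:
  assumes "star_automorphism f"
  shows "star_automorphism (inv_into UNIV f)"
proof -
  have b: "bij f" using assms by (simp add: star_automorphism_def)
  have eq: "inv_into UNIV f y = x \<longleftrightarrow> y = f x" for x y
    using b by (metis bij_inv_eq_iff)
  have s: "f (inv_into UNIV f x) = x" for x
    using eq[of x "inv_into UNIV f x"] by simp
  show ?thesis
    using assms unfolding star_automorphism_def by (simp add: bij_imp_bij_inv eq s)
qed

lemma group_Aut_cstar: "group (Aut_cstar :: ('a::unital_cstar_algebra \<Rightarrow> 'a) monoid)"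
proof (rule groupI)
  fix f :: "'a \<Rightarrow> 'a"
  assume "f \<in> carrier Aut_cstar"
  then have f: "star_automorphism f" by (simp add: Aut_cstar_def)
  then have "inv_into UNIV f \<circ> f = id" by (simp add: star_automorphism_def bij_def)
  with star_automorphism_inv[OF f]
  show "\<exists>g\<in>carrier Aut_cstar. g \<otimes>\<^bsub>Aut_cstar\<^esub> f = \<one>\<^bsub>Aut_cstar\<^esub>"
    by (auto simp: Aut_cstar_def)
qed (auto simp: Aut_cstar_def star_automorphism_def bij_comp o_assoc)

text \<open>
  Since \<open>group_Aut_cstar\<close> holds, the elements of \<open>hom G Aut_cstar\<close> are exactly the group
  homomorphisms from \<open>G\<close> to the group of *-automorphisms, i.e. the actions of \<open>G\<close>.
\<close>

definition projection :: "'a::unital_cstar_algebra \<Rightarrow> bool" where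
  "projection p \<longleftrightarrow> p * p = p \<and> adj p = p"

definition orthogonal_projections :: "'i set \<Rightarrow> ('i \<Rightarrow> 'a::unital_cstar_algebra) \<Rightarrow> bool" where
  "orthogonal_projections I e \<longleftrightarrow>
     (\<forall>i\<in>I. projection (e i)) \<and> (\<forall>i\<in>I. \<forall>j\<in>I. i \<noteq> j \<longrightarrow> e i * e j = 0)"

definition Rokhlin_property ::
    "('g, 'm) monoid_scheme \<Rightarrow> ('g \<Rightarrow> 'a::unital_cstar_algebra \<Rightarrow> 'a) \<Rightarrow> bool" where
  "Rokhlin_property G \<alpha> \<longleftrightarrow>
     (\<forall>F \<epsilon>. finite F \<longrightarrow> \<epsilon> > 0 \<longrightarrow>
       (\<exists>e. orthogonal_projections (carrier G) e \<and>
            (\<forall>g\<in>carrier G. \<forall>h\<in>carrier G. norm (\<alpha> g (e h) - e (g \<otimes>\<^bsub>G\<^esub> h)) < \<epsilon>) \<and>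
            (\<forall>g\<in>carrier G. \<forall>a\<in>F. norm (e g * a - a * e g) < \<epsilon>) \<and>
            (\<Sum>g\<in>carrier G. e g) = 1))"

end

theory Submission
  imports Defs
begin

text \<open>
  Averaging the given projections over the group makes them exactly equivariant, at the price of
  being only approximately orthogonal and idempotent. A Newton iteration for the equations
  \<open>b i * b j = (if i = j then b i else 0)\<close>, which preserves self-adjointness, equivariance and the
  condition \<open>sum b I = 1\<close>, converges quadratically to an exact solution nearby. Passing
  equivariance to the limit requires *-automorphisms to be continuous. This holds since a small
  self-adjoint \<open>y\<close> is the real part of the unitary \<open>y + \<i> sqrt (1 - y * y)\<close>, the square root
  coming from the contraction principle, and unitaries have norm at most 1.
\<close>

section \<open>C*-algebras and continuity of *-automorphisms\<close>

lemma norm_adj [simp]: "norm (adj x) = norm (x::'a::unital_cstar_algebra)"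
proof -
  have le: "norm y \<le> norm (adj y)" for y :: 'a
  proof (cases "norm y = 0")
    case False
    have "norm y * norm y = norm (adj y * y)"
      by (simp add: cstar_identity power2_eq_square)
    also have "\<dots> \<le> norm (adj y) * norm y"
      by (rule norm_mult_ineq)
    finally show ?thesis
      using False by (simp add: mult_le_cancel_right)
  qed simp
  show ?thesis
    using le[of x] le[of "adj x"] by (simp add: adj_adj)
qed

lemma adj_scaleR: "adj (r *\<^sub>R x) = r *\<^sub>R adj (x::'a::unital_cstar_algebra)"
  by (metis adj_scaleC complex_cnj_complex_of_real scaleC_of_real)

lemma bounded_linear_adj: "bounded_linear (adj :: 'a::unital_cstar_algebra \<Rightarrow> 'a)"
  by (rule bounded_linear_intro[of _ 1]) (simp_all add: adj_add adj_scaleR)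

lemmas adj_diff = linear_diff[OF bounded_linear.linear[OF bounded_linear_adj]]
lemmas adj_sum = linear_sum[OF bounded_linear.linear[OF bounded_linear_adj]]
lemmas continuous_on_adj [continuous_intros] = bounded_linear.continuous_on[OF bounded_linear_adj]

lemma adj_one: "adj 1 = (1::'a::unital_cstar_algebra)"
  by (metis adj_adj adj_mult mult.left_neutral mult.right_neutral)

lemma norm_projection_le_1: "norm p \<le> 1" if "projection (p::'a::unital_cstar_algebra)"
proof -
  have "norm p = (norm p)\<^sup>2"
    using cstar_identity[of p] that by (simp add: projection_def)
  then show ?thesis
    by (auto simp: power2_eq_square)
qed

lemma norm_isometry_le_1:
  assumes "adj u * u = (1::'a::unital_cstar_algebra)"
  shows "norm u \<le> 1"
proof -
  \<comment> \<open>Only an inequality is available: in the zero algebra \<open>norm 1\<close> is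
    0.\<close>
  have "norm (1::'a) \<le> 1"
    by (rule norm_projection_le_1) (simp add: projection_def adj_one)
  then have "(norm u)\<^sup>2 \<le> 1"
    using cstar_identity[of u] assms by simp
  then show ?thesis
    using power2_le_imp_le[of "norm u" 1] by simp
qed

text \<open>Substituting \<open>w = 1 - v\<close> turns \<open>w * w = 1 - x\<close> into the fixed
  point equation \<open>v = (1/2) *\<^sub>R (x + v * v)\<close>, whose right side is a contraction
  on the ball of radius 1/2. The element \<open>y\<close> is carried along because the application
  needs a root that commutes with it.\<close>

lemma sqrt_one_minus:
  fixes x :: "'a::unital_cstar_algebra"
  assumes x: "norm x \<le> 1/2" "adj x = x" and xy: "x * y = y * x"
  obtains w where "adj w = w" "w * y = y * w" "w * w = 1 - x"
proof -
  \<comment> \<open>Self-adjointness and commutation with \<open>y\<close> are closed conditions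
    preserved by \<open>T\<close>, so the fixed point inherits them. Radius 1/2 is preserved since
    \<open>(1/2) * (1/2 + 1/4) \<le> 1/2\<close>, and it makes \<open>T\<close> contract by the
    factor 1/2.\<close>
  define S where "S = {v::'a. norm v \<le> 1/2 \<and> adj v = v \<and> v * y = y * v}"
  define T where "T v = (1/2) *\<^sub>R (x + v * v)" for v :: 'a
  have "closed S"
    unfolding S_def by (intro closed_Collect_conj closed_Collect_le closed_Collect_eq continuous_intros)
  then have "complete S"
    by (simp add: complete_eq_closed)
  moreover have "0 \<in> S"
    by (simp add: S_def linear_0[OF bounded_linear.linear[OF bounded_linear_adj]])
  moreover have "T ` S \<subseteq> S"
  proof clarify
    fix v assume v: "v \<in> S"
    have "norm (x + v * v) \<le> norm x + norm v * norm v"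
      using norm_triangle_ineq[of x "v * v"] norm_mult_ineq[of v v] by linarith
    also have "norm v * norm v \<le> 1/2 * (1/2)"
      using v by (intro mult_mono) (auto simp: S_def)
    finally have "norm (T v) \<le> 1/2"
      using x by (simp add: T_def)
    moreover have "v * v * y = y * (v * v)"
      using v by (metis (mono_tags, lifting) S_def mem_Collect_eq mult.assoc)
    ultimately show "T v \<in> S"
      using v x xy by (auto simp: S_def T_def adj_scaleR adj_add adj_mult algebra_simps)
  qed
  moreover have "dist (T u) (T v) \<le> 1/2 * dist u v" if "u \<in> S" "v \<in> S" for u v
  proof -
    have "norm (u * u - v * v) = norm (u * (u - v) + (u - v) * v)"
      by (simp add: algebra_simps)
    also have "\<dots> \<le> norm u * norm (u - v) + norm (u - v) * norm v"
      using norm_triangle_ineq norm_mult_ineq by (meson add_mono order_trans)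
    also have "\<dots> \<le> 1/2 * norm (u - v) + norm (u - v) * (1/2)"
      using that by (intro add_mono mult_mono) (auto simp: S_def)
    finally have "norm (u * u - v * v) \<le> norm (u - v)"
      by simp
    moreover have "T u - T v = (1/2) *\<^sub>R (u * u - v * v)"
      by (simp add: T_def algebra_simps)
    ultimately show ?thesis
      by (simp add: dist_norm)
  qed
  ultimately obtain v where v: "v \<in> S" "T v = v"
    using Banach_fix[of S "1/2" T] by auto
  have "v + v = x + v * v"
    using v(2) scaleR_half_double[of v] unfolding T_def
    by (metis scaleR_half_double scaleR_right_distrib)
  then have "(1 - v) * (1 - v) = 1 - x"
    by (simp add: algebra_simps)
  moreover have "adj (1 - v) = 1 - v" "(1 - v) * y = y * (1 - v)"
    using v(1) by (auto simp: S_def adj_diff adj_one algebra_simps)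
  ultimately show thesis
    using that by blast
qed

text \<open>The bound is obtained first on small self-adjoint elements through unitaries, then on
  all self-adjoint elements by scaling, and finally on arbitrary \<open>x\<close> through
  \<open>adj x * x\<close>. The constant 2 is not sharp, but any constant gives continuity.\<close>

lemma star_automorphism_bounded_linear:
  fixes f :: "'a::unital_cstar_algebra \<Rightarrow> 'a"
  assumes "star_automorphism f"
  shows "bounded_linear f"
proof -
  have f: "f (x + y) = f x + f y" "f (scaleC c x) = scaleC c (f x)"
    "f (x * y) = f x * f y" "f (adj x) = adj (f x)" for x y c
    using assms by (auto simp: star_automorphism_def)
  have fR: "f (r *\<^sub>R x) = r *\<^sub>R f x" for r x
    by (metis f(2) scaleC_of_real)
  have lin: "linear f"
    by (rule linearI) (simp_all add: f fR)
  have "surj f"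
    using assms by (simp add: star_automorphism_def bij_def)
  \<comment> \<open>\<open>f 1\<close> is a unit for the range of \<open>f\<close>, which is the
    whole algebra.\<close>
  then have f1: "f 1 = 1"
    by (metis f(3) mult.left_neutral mult.right_neutral surjD)
  have small: "norm (f y) \<le> 1" if y: "norm y \<le> 1/2" "adj y = y" for y
  proof -
    have "norm (y * y) \<le> norm y * norm y"
      by (rule norm_mult_ineq)
    also have "\<dots> \<le> 1/2 * 1"
      using y by (intro mult_mono) auto
    finally obtain w where w: "adj w = w" "w * y = y * w" "w * w = 1 - y * y"
      using sqrt_one_minus[of "y * y" y] y by (auto simp: adj_mult mult.assoc)
    have m2: "scaleC \<i> (x - z) = scaleC \<i> x - scaleC \<i> z" for x z :: 'a
      using scaleC_add_right[of \<i> "x - z" z] by simp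
    \<comment> \<open>\<open>u\<close> is unitary because \<open>w\<close> commutes with
      \<open>y\<close> and \<open>w * w + y * y = 1\<close>. Both \<open>u\<close> and
      \<open>adj u\<close> then have images of norm at most 1, and \<open>y\<close> is their
      mean.\<close>
    define u where "u = y + scaleC \<i> w"
    have m1: "scaleC \<i> (scaleC \<i> x) = - x" "scaleC (-\<i>) x = - scaleC \<i> x" for x :: 'a
      using scaleC_of_real[of "-1" x] scaleC_add_left[of "-\<i>" \<i> x] scaleC_of_real[of 0 x]
      by (simp_all add: scaleC_scaleC eq_neg_iff_add_eq_0)
    have adju: "adj u = y - scaleC \<i> w"
      by (simp add: u_def adj_add adj_scaleC y w m1)
    have "adj u * u = 1" "adj (adj u) * adj u = 1"
      unfolding adj_adj unfolding adju unfolding u_def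
      by (simp_all add: algebra_simps mult_scaleC_left mult_scaleC_right m1 m2 w scaleC_add_right)
    then have "norm (f u) \<le> 1" "norm (f (adj u)) \<le> 1"
      by (metis f(3,4) f1 norm_isometry_le_1)+
    moreover have "y = (1/2) *\<^sub>R (u + adj u)"
      unfolding adju by (simp add: u_def scaleR_half_double flip: scaleR_add_right)
    then have "f y = (1/2) *\<^sub>R (f u + f (adj u))"
      by (metis f(1) fR)
    ultimately show ?thesis
      using norm_triangle_ineq[of "f u" "f (adj u)"] by simp
  qed
  have selfadj: "norm (f y) \<le> 2 * norm y" if y: "adj y = y" for y
  proof (cases "y = 0")
    case True
    then show ?thesis
      using linear_0[OF lin] by simp
  next
    case False
    \<comment> \<open>Rescaling to norm exactly 1/2 meets the hypothesis of \<open>small\<close> and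
      produces the factor 2.\<close>
    have "norm (f ((1 / (2 * norm y)) *\<^sub>R y)) \<le> 1"
      using False by (intro small) (simp_all add: adj_scaleR y)
    then show ?thesis
      using False by (simp add: fR field_simps)
  qed
  have "norm (f x) \<le> norm x * 2" for x
  proof (rule power2_le_imp_le)
    \<comment> \<open>The C*-identity on both sides reduces to the self-adjoint element
      \<open>adj x * x\<close>. The resulting factor 2 on squares is rounded up to 4.\<close>
    have "(norm (f x))\<^sup>2 = norm (f (adj x * x))"
      by (simp add: f cstar_identity)
    also have "\<dots> \<le> 2 * norm (adj x * x)"
      by (rule selfadj) (simp add: adj_mult adj_adj)
    also have "\<dots> \<le> (norm x * 2)\<^sup>2"
      by (simp add: cstar_identity power_mult_distrib)
    finally show "(norm (f x))\<^sup>2 \<le> (norm x * 2)\<^sup>2" .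
  qed simp
  then show ?thesis
    by (intro bounded_linear_intro[of f 2]) (simp_all add: f fR)
qed

section \<open>Perturbing approximate partitions of unity\<close>

text \<open>The defects all vanish exactly when the \<open>b i\<close> are mutually orthogonal
  idempotents. They measure how far the linear map sending the point mass at \<open>i\<close> to
  \<open>b i\<close> is from being multiplicative.\<close>

definition defect :: "('i \<Rightarrow> 'a::real_algebra) \<Rightarrow> 'i \<Rightarrow> 'i \<Rightarrow> 'a" where
  "defect b i j = b i * b j - (if i = j then b i else 0)"

text \<open>
  This is the step \<open>\<psi>' x = \<psi> x + (\<Sum>k. \<psi> p\<^sub>k * (\<psi> (p\<^sub>k * x) - \<psi> p\<^sub>k * \<psi> x))\<close> for an approximately
  multiplicative map \<open>\<psi>\<close> on the functions on \<open>I\<close> with point masses \<open>p\<^sub>k\<close>, symmetrized so that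
  self-adjointness is preserved.
\<close>
definition newton :: "'i set \<Rightarrow> ('i \<Rightarrow> 'a::real_algebra) \<Rightarrow> 'i \<Rightarrow> 'a" where
  "newton I b i = b i + b i * b i
     - (1/2) *\<^sub>R ((\<Sum>k\<in>I. b k * b k) * b i + b i * (\<Sum>k\<in>I. b k * b k))"

text \<open>This identity is the source of quadratic convergence: the terms linear in the old
  defects cancel. What remains are products of two defects or of two displacements \<open>r\<close>,
  and the displacements are themselves of first order in the defects.\<close>

lemma defect_newton:
  fixes b :: "'i \<Rightarrow> 'a::{real_algebra,monoid_mult}"
  assumes I: "finite I" and one: "sum b I = 1" and ij: "i \<in> I" "j \<in> I"
  defines "r \<equiv> \<lambda>i. newton I b i - b i" and "s \<equiv> \<Sum>k\<in>I. defect b k k"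
  shows "defect (newton I b) i j = r i * r j - (\<Sum>k\<in>I. defect b i k * defect b k j)
           - (1/2) *\<^sub>R (defect b i j * s + s * defect b i j)"
proof -
  define z where "z = (\<Sum>k\<in>I. b k * b k)"
  \<comment> \<open>Here \<open>sum b I = 1\<close> enters: the total diagonal defect is the
    deviation of the sum of squares from 1.\<close>
  have s: "s = z - 1"
    by (simp add: s_def defect_def z_def sum_subtractf one)
  \<comment> \<open>The diagonal corrections survive only at \<open>k = i\<close> and
    \<open>k = j\<close>, so the sum collapses to an expression with \<open>z\<close> in the
    middle.\<close>
  have "(\<Sum>k\<in>I. defect b i k * defect b k j)
      = (\<Sum>k\<in>I. b i * (b k * b k) * b j - (if k = i then b i * b i * b j else 0)
          - (if k = j then b i * b j * b j else 0)
          + (if k = i then if i = j then b i * b i else 0 else 0))"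
    by (intro sum.cong refl) (auto simp: defect_def algebra_simps)
  also have "\<dots> = b i * z * b j - b i * b i * b j - b i * b j * b j + (if i = j then b i * b i else 0)"
    using I ij by (simp add: sum.distrib sum_subtractf z_def sum_distrib_left sum_distrib_right)
  finally have dd: "(\<Sum>k\<in>I. defect b i k * defect b k j) = \<dots>" .
  have nw: "newton I b i = b i + b i * b i - (1/2) *\<^sub>R (z * b i + b i * z)" for i
    by (simp add: newton_def z_def)
  \<comment> \<open>Symmetrizing splits terms such as \<open>b i * z * b j\<close> into two halves;
    instances of this equation let whole terms cancel against them.\<close>
  have half: "x = (1/2) *\<^sub>R x + (1/2) *\<^sub>R x" for x :: 'a
    by (simp flip: scaleR_add_left)
  show ?thesis
  proof (cases "i = j")
    case True
    have "b j * (z * b j) = (1/2) *\<^sub>R (b j * (z * b j)) + (1/2) *\<^sub>R (b j * (z * b j))"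
      by (rule half)
    then show ?thesis
      using True half[of "b j"] half[of "b j * b j"]
      unfolding dd unfolding s r_def defect_def nw by (simp add: algebra_simps)
  next
    case False
    have "b i * (z * b j) = (1/2) *\<^sub>R (b i * (z * b j)) + (1/2) *\<^sub>R (b i * (z * b j))"
      by (rule half)
    then show ?thesis
      using False half[of "b i * b j"]
      unfolding dd unfolding s r_def defect_def nw by (simp add: algebra_simps)
  qed
qed

lemma sum_newton:
  fixes b :: "'i \<Rightarrow> 'a::{real_algebra,monoid_mult}"
  assumes "sum b I = 1"
  shows "sum (newton I b) I = 1"
proof -
  define z where "z = (\<Sum>k\<in>I. b k * b k)"
  have "sum (newton I b) I = 1 + z - (1/2) *\<^sub>R (z * sum b I + sum b I * z)"
    by (simp add: newton_def sum.distrib sum_subtractf assms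
        flip: z_def scaleR_sum_right sum_distrib_left sum_distrib_right)
  then show ?thesis
    by (simp add: assms scaleR_half_double)
qed

text \<open>The sum of squares is invariant under reindexing by \<open>\<sigma>\<close>, hence fixed
  by \<open>f\<close>; the rest of the formula involves only \<open>b i\<close>.\<close>

lemma newton_equivariant:
  assumes "linear f" and f: "\<And>x y. f (x * y) = f x * f y"
    and \<sigma>: "bij_betw \<sigma> I I" and b: "\<And>i. i \<in> I \<Longrightarrow> f (b i) = b (\<sigma> i)" and i: "i \<in> I"
  shows "f (newton I b i) = newton I b (\<sigma> i)"
proof -
  interpret linear f by fact
  have "f (\<Sum>k\<in>I. b k * b k) = (\<Sum>k\<in>I. b (\<sigma> k) * b (\<sigma> k))"
    by (simp add: sum f b)
  also have "\<dots> = (\<Sum>k\<in>I. b k * b k)"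
    by (rule sum.reindex_bij_betw[OF \<sigma>])
  finally show ?thesis
    using i by (simp add: newton_def add diff scale f b)
qed

section \<open>Approximate partitions of unity and convergence of the Newton iteration\<close>

definition approx_partition :: "'i set \<Rightarrow> real \<Rightarrow> ('i \<Rightarrow> 'a::unital_cstar_algebra) \<Rightarrow> bool" where
  "approx_partition I \<delta> b \<longleftrightarrow> (\<forall>i\<in>I. adj (b i) = b i) \<and> sum b I = 1 \<and>
     (\<forall>i\<in>I. \<forall>j\<in>I. norm (defect b i j) \<le> \<delta>)"

lemma approx_partition_0_iff:
  "approx_partition I 0 p \<longleftrightarrow> orthogonal_projections I p \<and> sum p I = 1"
  by (auto simp: approx_partition_def orthogonal_projections_def projection_def defect_def)

text \<open>For self-adjoint \<open>b i\<close> the C*-identity gives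
  \<open>t * t \<le> 1 + t\<close> for its norm \<open>t\<close>, which fails when
  \<open>t > 2\<close>.\<close>

lemma approx_partition_norm_le_2:
  assumes "approx_partition I \<delta> b" "\<delta> \<le> 1" "i \<in> I"
  shows "norm (b i) \<le> 2"
proof -
  have "(norm (b i))\<^sup>2 = norm (b i * b i)"
    using assms cstar_identity[of "b i"] by (simp add: approx_partition_def)
  also have "\<dots> = norm (defect b i i + b i)"
    by (simp add: defect_def)
  also have "\<dots> \<le> 1 + norm (b i)"
    using norm_triangle_ineq[of "defect b i i" "b i"] assms
    by (fastforce simp: approx_partition_def)
  finally have "norm (b i) * norm (b i) \<le> 1 + norm (b i)"
    by (simp add: power2_eq_square)
  moreover have "2 * norm (b i) \<le> norm (b i) * norm (b i)" if "norm (b i) > 2"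
    using that by (intro mult_right_mono) auto
  ultimately show ?thesis
    by linarith
qed

text \<open>One step moves the family by an amount of first order in \<open>\<delta>\<close>, while
  the new defects are of second order by \<open>defect_newton\<close>.\<close>

lemma newton_step:
  fixes b :: "'i \<Rightarrow> 'a::unital_cstar_algebra"
  assumes I: "finite I" and b: "approx_partition I \<delta> b" and \<delta>: "0 \<le> \<delta>" "\<delta> \<le> 1"
  shows newton_step_dist: "\<And>i. i \<in> I \<Longrightarrow> norm (newton I b i - b i) \<le> 3 * real (card I) * \<delta>"
    and newton_step_defect: "approx_partition I (11 * (real (card I))\<^sup>2 * \<delta>\<^sup>2) (newton I b)"
proof -
  define N where "N = real (card I)"
  define s where "s = (\<Sum>k\<in>I. defect b k k)"
  have one: "sum b I = 1" and sa: "adj (b i) = b i" if "i \<in> I" for i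
    using b that by (auto simp: approx_partition_def)
  have d: "norm (defect b i j) \<le> \<delta>" if "i \<in> I" "j \<in> I" for i j
    using b that by (auto simp: approx_partition_def)
  have N1: "1 \<le> N" if "i \<in> I" for i
    using I that by (auto simp: N_def Suc_le_eq card_gt_0_iff)
  have s: "norm s \<le> N * \<delta>"
    unfolding s_def N_def using d by (intro sum_norm_bound) auto
  have prod: "norm (x * y) \<le> c * e" if "norm x \<le> c" "norm y \<le> e" for x y :: 'a and c e
    using norm_mult_ineq[of x y] mult_mono[OF that] that norm_ge_zero[of x]
    by (smt (verit) norm_ge_zero)
  have half: "norm ((1/2) *\<^sub>R (x + y)) \<le> c" if "norm x \<le> c" "norm y \<le> c" for x y :: 'a and c
    using norm_triangle_ineq[of x y] that by simp
  have r: "norm (newton I b i - b i) \<le> 3 * N * \<delta>" if i: "i \<in> I" for i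
  proof -
    have "s = (\<Sum>k\<in>I. b k * b k) - 1"
      using one i by (simp add: s_def defect_def sum_subtractf)
    then have z: "(\<Sum>k\<in>I. b k * b k) = s + 1"
      by simp
    \<comment> \<open>Writing the sum of squares as \<open>s + 1\<close> exhibits the displacement
      as first order in the defects. With \<open>norm (b i) \<le> 2\<close> and
      \<open>norm s \<le> N * \<delta>\<close> it is at most
      \<open>\<delta> + 2 * N * \<delta>\<close>.\<close>
    have "newton I b i - b i = defect b i i - (1/2) *\<^sub>R (s * b i + b i * s)"
    proof -
      have "b i = (1/2) *\<^sub>R b i + (1/2) *\<^sub>R b i"
        by (simp flip: scaleR_add_left)
      then show ?thesis
        unfolding newton_def z defect_def by (simp add: algebra_simps)
    qed
    also have "norm \<dots> \<le> \<delta> + 2 * N * \<delta>"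
    proof (intro order_trans[OF norm_triangle_ineq4] add_mono half)
      show "norm (s * b i) \<le> 2 * N * \<delta>"
        using prod[OF s approx_partition_norm_le_2[OF b \<delta>(2) i]] by (simp add: mult_ac)
      show "norm (b i * s) \<le> 2 * N * \<delta>"
        using prod[OF approx_partition_norm_le_2[OF b \<delta>(2) i] s] by (simp add: mult_ac)
    qed (use d i in auto)
    also have "\<dots> \<le> 3 * N * \<delta>"
      using mult_right_mono[OF N1[OF i] \<delta>(1)] by simp
    finally show ?thesis .
  qed
  then show "norm (newton I b i - b i) \<le> 3 * real (card I) * \<delta>" if "i \<in> I" for i
    using that by (simp add: N_def)
  have "norm (defect (newton I b) i j) \<le> 11 * N\<^sup>2 * \<delta>\<^sup>2" if ij: "i \<in> I" "j \<in> I" for i j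
  proof -
    \<comment> \<open>One summand for each part of \<open>defect_newton\<close>. The constant 11 is
      9 from the product of displacements plus 1 from each of the other two, using
      \<open>N \<le> N * N\<close>.\<close>
    have "norm (defect (newton I b) i j) \<le> (3 * N * \<delta>) * (3 * N * \<delta>) + N * (\<delta> * \<delta>) + \<delta> * (N * \<delta>)"
      unfolding defect_newton[OF I one[OF ij(1)] ij] s_def[symmetric]
    proof (intro order_trans[OF norm_triangle_ineq4] add_mono half)
      show "norm (\<Sum>k\<in>I. defect b i k * defect b k j) \<le> N * (\<delta> * \<delta>)"
        unfolding N_def using ij by (intro sum_norm_bound prod d)
      show "norm (s * defect b i j) \<le> \<delta> * (N * \<delta>)"
        using prod[OF s d[OF ij]] by (simp add: mult_ac)
    qed (intro prod r d ij s)+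
    also have "\<dots> = 9 * N\<^sup>2 * \<delta>\<^sup>2 + 2 * (N * 1) * \<delta>\<^sup>2"
      by (simp add: power2_eq_square)
    also have "\<dots> \<le> 9 * N\<^sup>2 * \<delta>\<^sup>2 + 2 * (N * N) * \<delta>\<^sup>2"
      using N1[OF ij(1)] by (intro add_mono mult_right_mono mult_left_mono) auto
    finally show ?thesis
      by (simp add: power2_eq_square)
  qed
  moreover have "adj (newton I b i) = newton I b i" if "i \<in> I" for i
    using that by (simp add: newton_def adj_add adj_diff adj_scaleR adj_mult adj_sum sa add.commute)
  moreover have "sum (newton I b) I = 1"
    using b by (simp add: approx_partition_def sum_newton)
  ultimately show "approx_partition I (11 * (real (card I))\<^sup>2 * \<delta>\<^sup>2) (newton I b)"
    by (simp add: approx_partition_def N_def)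
qed

lemma approx_partition_mono:
  "approx_partition I \<delta> b \<Longrightarrow> \<delta> \<le> \<delta>' \<Longrightarrow> approx_partition I \<delta>' b"
  unfolding approx_partition_def by (meson order_trans)

text \<open>The smallness assumption turns the new defect bound
  \<open>11 * N\<^sup>2 * \<delta>\<^sup>2\<close> into at most \<open>\<delta> / 2\<close>, so each
  step at least halves the bound. Displacements are then dominated by a geometric series with sum
  \<open>6 * N * \<delta>\<close>. Convergence of the iterates is part of the conclusion so that
  equivariance can be passed to the limit.\<close>

lemma newton_limit:
  fixes b :: "'i \<Rightarrow> 'a::unital_cstar_algebra"
  assumes I: "finite I" "I \<noteq> {}" and b: "approx_partition I \<delta> b"
    and \<delta>: "0 \<le> \<delta>" "22 * (real (card I))\<^sup>2 * \<delta> \<le> 1"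
  obtains p where "orthogonal_projections I p" "sum p I = 1"
    "\<And>i. i \<in> I \<Longrightarrow> norm (p i - b i) \<le> 6 * real (card I) * \<delta>"
    "\<And>i. i \<in> I \<Longrightarrow> (\<lambda>n. (newton I ^^ n) b i) \<longlonglongrightarrow> p i"
proof -
  define N where "N = real (card I)"
  define c where "c n = (newton I ^^ n) b" for n
  have c0: "c 0 = b" and cS: "c (Suc n) = newton I (c n)" for n
    by (simp_all add: c_def)
  have "1 \<le> N"
    using I by (simp add: N_def Suc_le_eq card_gt_0_iff)
  then have "1 \<le> N\<^sup>2"
    by simp
  then have "1 * \<delta> \<le> 22 * N\<^sup>2 * \<delta>"
    using \<delta>(1) by (intro mult_right_mono) auto
  then have \<delta>1: "\<delta> \<le> 1"
    using \<delta>(2) by (simp add: N_def)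
  have small: "\<delta> * (1/2)^n \<le> \<delta>" for n
    using \<delta>(1) by (intro mult_left_le) (auto simp: power_le_one)
  have c: "approx_partition I (\<delta> * (1/2)^n) (c n)" for n
  proof (induction n)
    case 0
    then show ?case
      using b by (simp add: c0)
  next
    case (Suc n)
    let ?d = "\<delta> * (1/2)^n"
    have d0: "0 \<le> ?d"
      using \<delta>(1) by simp
    have "approx_partition I (11 * N\<^sup>2 * ?d\<^sup>2) (c (Suc n))"
      unfolding cS N_def using small[of n] \<delta>1 by (intro newton_step_defect[OF I(1) Suc d0]) linarith
    moreover have "11 * N\<^sup>2 * ?d\<^sup>2 \<le> \<delta> * (1/2)^Suc n"
    proof -
      have "22 * N\<^sup>2 * ?d \<le> 22 * N\<^sup>2 * \<delta>"
        using small[of n] by (intro mult_left_mono) auto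
      then have "22 * N\<^sup>2 * ?d * ?d \<le> 1 * ?d"
        using d0 \<delta>(2) unfolding N_def by (intro mult_right_mono) linarith+
      then show ?thesis
        by (simp add: power2_eq_square mult_ac)
    qed
    ultimately show ?case
      by (rule approx_partition_mono)
  qed
  \<comment> \<open>As an absolutely convergent telescoping series, \<open>p\<close> is the limit of
    the iterates, and its distance to \<open>b\<close> is bounded by the sum of the step
    lengths.\<close>
  define p where "p i = b i + (\<Sum>n. c (Suc n) i - c n i)" for i
  have step: "norm (c (Suc n) i - c n i) \<le> 3 * N * \<delta> * (1/2)^n" if "i \<in> I" for i n
    using newton_step_dist[OF I(1) c[of n] _ _ that] \<delta>(1) \<delta>1 small[of n]
    by (simp add: cS N_def mult.assoc)
  have geo: "(\<lambda>n. 3 * N * \<delta> * (1/2)^n) sums (6 * N * \<delta>)"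
    using sums_mult[OF geometric_sums[of "1/2::real"], of "3 * N * \<delta>"] by (simp add: mult.assoc)
  have summ: "summable (\<lambda>n. norm (c (Suc n) i - c n i))" if "i \<in> I" for i
    using step[OF that] by (intro summable_comparison_test'[OF sums_summable[OF geo], of 0]) simp
  have lim: "(\<lambda>n. c n i) \<longlonglongrightarrow> p i" if i: "i \<in> I" for i
  proof -
    have "(\<lambda>n. \<Sum>k<n. c (Suc k) i - c k i) \<longlonglongrightarrow> (\<Sum>n. c (Suc n) i - c n i)"
      using summable_norm_cancel[OF summ[OF i]] summable_LIMSEQ by blast
    then have "(\<lambda>n. b i + (\<Sum>k<n. c (Suc k) i - c k i)) \<longlonglongrightarrow> p i"
      unfolding p_def by (intro tendsto_intros)
    then show ?thesis
      using sum_lessThan_telescope[of "\<lambda>n. c n i"] by (simp add: c0)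
  qed
  have "norm (p i - b i) \<le> 6 * N * \<delta>" if i: "i \<in> I" for i
  proof -
    have "norm (p i - b i) \<le> (\<Sum>n. norm (c (Suc n) i - c n i))"
      unfolding p_def using summable_norm[OF summ[OF i]] by simp
    also have "\<dots> \<le> (\<Sum>n. 3 * N * \<delta> * (1/2)^n)"
      by (intro suminf_le step[OF i] summ[OF i] sums_summable[OF geo])
    also have "\<dots> = 6 * N * \<delta>"
      using geo by (simp add: sums_iff)
    finally show ?thesis .
  qed
  moreover have "approx_partition I 0 p"
    unfolding approx_partition_def
  proof (intro conjI ballI)
    fix i assume i: "i \<in> I"
    have "(\<lambda>n. adj (c n i)) \<longlonglongrightarrow> adj (p i)"
      by (rule bounded_linear.tendsto[OF bounded_linear_adj lim[OF i]])
    then show "adj (p i) = p i"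
      using LIMSEQ_unique lim[OF i] c i by (simp add: approx_partition_def)
    fix j assume j: "j \<in> I"
    have "(\<lambda>n. norm (defect (c n) i j)) \<longlonglongrightarrow> norm (defect p i j)"
      using lim[OF i] lim[OF j] unfolding defect_def by (cases "i = j") (auto intro!: tendsto_intros)
    moreover have "(\<lambda>n. \<delta> * (1/2)^n) \<longlonglongrightarrow> \<delta> * 0"
      by (intro tendsto_intros LIMSEQ_power_zero) simp
    ultimately show "norm (defect p i j) \<le> 0"
      using c i j by (intro LIMSEQ_le[where X = "\<lambda>n. norm (defect (c n) i j)"])
        (auto simp: approx_partition_def)
  next
    have "(\<lambda>n. sum (c n) I) \<longlonglongrightarrow> sum p I"
      by (intro tendsto_sum lim)
    then show "sum p I = 1"
      using c by (simp add: approx_partition_def LIMSEQ_const_iff)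
  qed
  ultimately show thesis
    using that lim unfolding c_def N_def approx_partition_0_iff by blast
qed

section \<open>Equivariance\<close>

lemma (in group) bij_betw_mult_left: "g \<in> carrier G \<Longrightarrow> bij_betw ((\<otimes>) g) (carrier G) (carrier G)"
  by (rule bij_betwI[where g = "(\<otimes>) (inv g)"]) (auto simp flip: m_assoc)

text \<open>The average \<open>b\<close> is within \<open>\<delta>\<close> of \<open>e\<close> and
  has defects at most \<open>4 * \<delta>\<close>. Applying \<open>newton_limit\<close> with
  \<open>4 * \<delta>\<close> explains 88 as \<open>22 * 4\<close>, and 25 as \<open>6 * 4\<close>
  plus 1 for the averaging, since \<open>N \<ge> 1\<close>.\<close>

lemma Rokhlin_projections_equivariant:
  fixes G :: "('g, 'm) monoid_scheme" (structure)
    and \<alpha> :: "'g \<Rightarrow> 'a::unital_cstar_algebra \<Rightarrow> 'a"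
  assumes "group G" and fin: "finite (carrier G)" and \<alpha>: "\<alpha> \<in> hom G Aut_cstar"
    and e: "orthogonal_projections (carrier G) e" "sum e (carrier G) = 1"
    and close: "\<And>g h. g \<in> carrier G \<Longrightarrow> h \<in> carrier G \<Longrightarrow> norm (\<alpha> g (e h) - e (g \<otimes> h)) \<le> \<delta>"
    and \<delta>: "88 * (real (card (carrier G)))\<^sup>2 * \<delta> \<le> 1"
  obtains p where "orthogonal_projections (carrier G) p" "sum p (carrier G) = 1"
    "\<And>g h. g \<in> carrier G \<Longrightarrow> h \<in> carrier G \<Longrightarrow> \<alpha> g (p h) = p (g \<otimes> h)"
    "\<And>h. h \<in> carrier G \<Longrightarrow> norm (p h - e h) \<le> 25 * real (card (carrier G)) * \<delta>"
proof -
  interpret group G by fact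
  define N where "N = real (card (carrier G))"
  have ne: "carrier G \<noteq> {}"
    using one_closed by blast
  have N1: "1 \<le> N"
    using fin ne by (simp add: N_def Suc_le_eq card_gt_0_iff)
  have \<delta>0: "0 \<le> \<delta>"
    using close[OF one_closed one_closed] norm_ge_zero order_trans by blast
  have "1 * \<delta> \<le> 88 * N\<^sup>2 * \<delta>"
    using \<delta>0 one_le_power[OF N1, of 2] by (intro mult_right_mono) linarith+
  then have \<delta>1: "\<delta> \<le> 1"
    using \<delta> by (simp add: N_def)
  have aut: "star_automorphism (\<alpha> g)" if "g \<in> carrier G" for g
    using hom_in_carrier[OF \<alpha> that] by (simp add: Aut_cstar_def)
  note bl = star_automorphism_bounded_linear[OF aut]
  note lin = bounded_linear.linear[OF bl]
  have \<alpha>_mult: "\<alpha> g (x * y) = \<alpha> g x * \<alpha> g y" and \<alpha>_adj: "\<alpha> g (adj x) = adj (\<alpha> g x)"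
    if "g \<in> carrier G" for g x y
    using aut[OF that] by (auto simp: star_automorphism_def)
  have "surj (\<alpha> g)" if "g \<in> carrier G" for g
    using aut[OF that] by (simp add: star_automorphism_def bij_def)
  then have \<alpha>1: "\<alpha> g 1 = 1" if "g \<in> carrier G" for g
    using that by (metis \<alpha>_mult mult_1_left mult_1_right surjD)
  have comp: "\<alpha> g (\<alpha> h x) = \<alpha> (g \<otimes> h) x" if "g \<in> carrier G" "h \<in> carrier G" for g h x
    using hom_mult[OF \<alpha> that] by (simp add: Aut_cstar_def)
  have norm_e: "norm (e h) \<le> 1" and adj_e: "adj (e h) = e h" if "h \<in> carrier G" for h
    using e(1) that by (auto simp: orthogonal_projections_def projection_def intro: norm_projection_le_1)
  \<comment> \<open>By \<open>close\<close>, every summand is within \<open>\<delta>\<close> of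
    \<open>e h\<close>. Applying \<open>\<alpha> k\<close> and substituting
    \<open>k \<otimes> g\<close> for \<open>g\<close> shifts \<open>h\<close> to
    \<open>k \<otimes> h\<close>, so the average is exactly equivariant.\<close>
  define b where "b h = (1/N) *\<^sub>R (\<Sum>g\<in>carrier G. \<alpha> g (e (inv g \<otimes> h)))" for h
  have equiv: "\<alpha> k (b h) = b (k \<otimes> h)" if kh: "k \<in> carrier G" "h \<in> carrier G" for k h
  proof -
    have "inv (k \<otimes> g) \<otimes> (k \<otimes> h) = inv g \<otimes> h" if "g \<in> carrier G" for g
    proof -
      have "inv k \<otimes> (k \<otimes> h) = h"
        using kh by (simp flip: m_assoc)
      then show ?thesis
        using kh that by (simp add: inv_mult_group m_assoc)
    qed
    then have "\<alpha> k (\<Sum>g\<in>carrier G. \<alpha> g (e (inv g \<otimes> h)))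
        = (\<Sum>g\<in>carrier G. \<alpha> (k \<otimes> g) (e (inv (k \<otimes> g) \<otimes> (k \<otimes> h))))"
      unfolding linear_sum[OF lin[OF kh(1)]]
      using kh by (intro sum.cong refl) (simp add: comp)
    also have "\<dots> = (\<Sum>g\<in>carrier G. \<alpha> g (e (inv g \<otimes> (k \<otimes> h))))"
      by (rule sum.reindex_bij_betw[OF bij_betw_mult_left[OF kh(1)]])
    finally show ?thesis
      using kh(1) by (simp add: b_def linear_scale[OF lin])
  qed
  have be: "norm (b h - e h) \<le> \<delta>" if h: "h \<in> carrier G" for h
  proof -
    have "b h - e h = (1/N) *\<^sub>R (\<Sum>g\<in>carrier G. \<alpha> g (e (inv g \<otimes> h)) - e h)"
      using N1 by (simp add: b_def sum_subtractf scaleR_diff_right sum_constant_scaleR N_def)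
    moreover have "norm (\<Sum>g\<in>carrier G. \<alpha> g (e (inv g \<otimes> h)) - e h) \<le> N * \<delta>"
      unfolding N_def
    proof (rule sum_norm_bound)
      fix g assume g: "g \<in> carrier G"
      then have "g \<otimes> (inv g \<otimes> h) = h"
        using h by (simp flip: m_assoc)
      then show "norm (\<alpha> g (e (inv g \<otimes> h)) - e h) \<le> \<delta>"
        using close[of g "inv g \<otimes> h"] g h by simp
    qed
    ultimately show ?thesis
      using N1 by (simp add: field_simps)
  qed
  have part: "approx_partition (carrier G) (4 * \<delta>) b"
    unfolding approx_partition_def
  proof (intro conjI ballI)
    fix i j assume i: "i \<in> carrier G" and j: "j \<in> carrier G"
    have "norm (b i) \<le> 1 + \<delta>"
      using norm_triangle_ineq[of "e i" "b i - e i"] be[OF i] norm_e[OF i] by simp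
    then have nb: "norm (b i) \<le> 2"
      using \<delta>1 by simp
    have ee: "e i * e j = (if i = j then e i else 0)"
      using e(1) i j by (auto simp: orthogonal_projections_def projection_def)
    \<comment> \<open>The family \<open>e\<close> has zero defect, so only the replacement errors
      remain: \<open>2 * \<delta>\<close>, \<open>\<delta>\<close> and
      \<open>\<delta>\<close>.\<close>
    have "defect b i j = b i * (b j - e j) + (b i - e i) * e j - (if i = j then b i - e i else 0)"
      unfolding defect_def using ee by (auto simp: algebra_simps)
    also have "norm \<dots> \<le> 2 * \<delta> + \<delta> * 1 + \<delta>"
    proof (intro order_trans[OF norm_triangle_ineq4] order_trans[OF norm_triangle_ineq] add_mono)
      show "norm (b i * (b j - e j)) \<le> 2 * \<delta>"
        by (intro order_trans[OF norm_mult_ineq] mult_mono nb be j) auto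
      show "norm ((b i - e i) * e j) \<le> \<delta> * 1"
        by (intro order_trans[OF norm_mult_ineq] mult_mono norm_e be i j \<delta>0) auto
    qed (use be[OF i] \<delta>0 in auto)
    finally show "norm (defect b i j) \<le> 4 * \<delta>"
      by simp
  next
    fix h assume "h \<in> carrier G"
    then show "adj (b h) = b h"
      unfolding b_def adj_scaleR adj_sum by (simp add: adj_e flip: \<alpha>_adj)
  next
    \<comment> \<open>Summing over \<open>h\<close> first, left translation by \<open>inv g\<close>
      permutes the group, so each inner sum is \<open>\<alpha> g 1 = 1\<close>.\<close>
    have "sum b (carrier G) = (1/N) *\<^sub>R (\<Sum>g\<in>carrier G. \<Sum>h\<in>carrier G. \<alpha> g (e (inv g \<otimes> h)))"
      unfolding b_def scaleR_sum_right[symmetric] by (subst sum.swap) (rule refl)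
    also have "(\<Sum>g\<in>carrier G. \<Sum>h\<in>carrier G. \<alpha> g (e (inv g \<otimes> h))) = (\<Sum>g\<in>carrier G. 1)"
    proof (rule sum.cong[OF refl])
      fix g assume g: "g \<in> carrier G"
      have "(\<Sum>h\<in>carrier G. e (inv g \<otimes> h)) = 1"
        using sum.reindex_bij_betw[OF bij_betw_mult_left[of "inv g"], of e] e(2) g by simp
      then show "(\<Sum>h\<in>carrier G. \<alpha> g (e (inv g \<otimes> h))) = 1"
        using g by (simp add: \<alpha>1 flip: linear_sum[OF lin[OF g]])
    qed
    finally show "sum b (carrier G) = 1"
      using N1 by (simp add: sum_constant_scaleR N_def)
  qed
  obtain p where p: "orthogonal_projections (carrier G) p" "sum p (carrier G) = 1"
    "\<And>i. i \<in> carrier G \<Longrightarrow> norm (p i - b i) \<le> 6 * N * (4 * \<delta>)"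
    "\<And>i. i \<in> carrier G \<Longrightarrow> (\<lambda>n. (newton (carrier G) ^^ n) b i) \<longlonglongrightarrow> p i"
    using newton_limit[OF fin ne part] \<delta>0 \<delta> unfolding N_def by auto
  \<comment> \<open>One sequence has both sides as limits: equivariance of each iterate gives the
    right side, continuity of \<open>\<alpha> g\<close> the left.\<close>
  have "\<alpha> g (p h) = p (g \<otimes> h)" if gh: "g \<in> carrier G" "h \<in> carrier G" for g h
  proof (rule LIMSEQ_unique)
    have "\<alpha> g ((newton (carrier G) ^^ n) b h) = (newton (carrier G) ^^ n) b (g \<otimes> h)"
      if "h \<in> carrier G" for n h
      using that
    proof (induction n arbitrary: h)
      case 0
      then show ?case
        using equiv gh(1) by simp
    next
      case (Suc n)
      show ?case
        unfolding funpow.simps comp_apply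
        by (rule newton_equivariant[where \<sigma> = "(\<otimes>) g", OF lin[OF gh(1)] \<alpha>_mult[OF gh(1)]
              bij_betw_mult_left[OF gh(1)]]) (simp_all add: Suc)
    qed
    then show "(\<lambda>n. \<alpha> g ((newton (carrier G) ^^ n) b h)) \<longlonglongrightarrow> p (g \<otimes> h)"
      using p(4)[of "g \<otimes> h"] gh by simp
    show "(\<lambda>n. \<alpha> g ((newton (carrier G) ^^ n) b h)) \<longlonglongrightarrow> \<alpha> g (p h)"
      by (rule bounded_linear.tendsto[OF bl[OF gh(1)] p(4)[OF gh(2)]])
  qed
  moreover have "norm (p h - e h) \<le> 25 * N * \<delta>" if h: "h \<in> carrier G" for h
  proof -
    have "norm (p h - e h) \<le> norm (p h - b h) + norm (b h - e h)"
      using norm_triangle_ineq[of "p h - b h" "b h - e h"] by simp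
    then show ?thesis
      using p(3)[OF h] be[OF h] mult_right_mono[OF N1 \<delta>0] by simp
  qed
  ultimately show thesis
    using that p(1,2) unfolding N_def by blast
qed

section \<open>Equivalence of approximate and exact equivariance\<close>

theorem proposition5p26:
  fixes G :: "('g, 'm) monoid_scheme"
    and \<alpha> :: "'g \<Rightarrow> 'a::unital_cstar_algebra \<Rightarrow> 'a"
  assumes "separable_space (euclidean :: 'a topology)"
    and "group G" and "finite (carrier G)"
    and "\<alpha> \<in> hom G Aut_cstar"
  shows "Rokhlin_property G \<alpha> \<longleftrightarrow>
    (\<forall>(F :: 'a set) (\<epsilon> :: real). finite F \<longrightarrow> \<epsilon> > 0 \<longrightarrow>
      (\<exists>e :: 'g \<Rightarrow> 'a. orthogonal_projections (carrier G) e \<and>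
        (\<forall>g\<in>carrier G. \<forall>h\<in>carrier G. \<alpha> g (e h) = e (g \<otimes>\<^bsub>G\<^esub> h)) \<and>
        (\<forall>g\<in>carrier G. \<forall>a\<in>F. norm (e g * a - a * e g) < \<epsilon>) \<and>
        (\<Sum>g\<in>carrier G. e g) = 1))"
    (is "_ \<longleftrightarrow> ?exact")
proof
  assume rok: "Rokhlin_property G \<alpha>"
  show ?exact
  proof (intro allI impI)
    fix F :: "'a set" and \<epsilon> :: real
    assume F: "finite F" and \<epsilon>: "\<epsilon> > 0"
    define N where "N = real (card (carrier G))"
    \<comment> \<open>A sum instead of a maximum, so that an empty \<open>F\<close> needs no
      separate case.\<close>
    define M where "M = (\<Sum>a\<in>F. norm a)"
    have M: "norm a \<le> M" if "a \<in> F" for a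
      unfolding M_def using F that by (intro member_le_sum) auto
    have M0: "0 \<le> M"
      by (simp add: M_def sum_nonneg)
    have "carrier G \<noteq> {}"
      using assms(2) group.is_monoid monoid.one_closed by blast
    then have N0: "0 < N"
      using assms(3) by (simp add: N_def card_gt_0_iff)
    have pos: "0 < 1 + 50 * N * M"
      using N0 M0 by (simp add: add_pos_nonneg)
    \<comment> \<open>The first bound is what \<open>Rokhlin_projections_equivariant\<close>
      requires. The second pays for the commutators: replacing \<open>e g\<close> by
      \<open>p g\<close> adds at most \<open>2 * (25 * N * \<delta>) * M\<close> to an error below
      \<open>\<delta>\<close>.\<close>
    define \<delta> where "\<delta> = min (1 / (88 * N\<^sup>2)) (\<epsilon> / (1 + 50 * N * M))"
    have \<delta>0: "0 < \<delta>"
      using N0 pos \<epsilon> by (simp add: \<delta>_def)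
    have "\<delta> \<le> 1 / (88 * N\<^sup>2)" "\<delta> \<le> \<epsilon> / (1 + 50 * N * M)"
      by (simp_all add: \<delta>_def)
    then have \<delta>: "88 * N\<^sup>2 * \<delta> \<le> 1" "\<delta> * (1 + 50 * N * M) \<le> \<epsilon>"
      using N0 pos by (simp_all add: field_simps)
    obtain e where e: "orthogonal_projections (carrier G) e" "sum e (carrier G) = 1"
      "\<And>g h. g \<in> carrier G \<Longrightarrow> h \<in> carrier G \<Longrightarrow> norm (\<alpha> g (e h) - e (g \<otimes>\<^bsub>G\<^esub> h)) < \<delta>"
      "\<And>g a. g \<in> carrier G \<Longrightarrow> a \<in> F \<Longrightarrow> norm (e g * a - a * e g) < \<delta>"
      using rok F \<delta>0 unfolding Rokhlin_property_def by metis
    obtain p where p: "orthogonal_projections (carrier G) p" "sum p (carrier G) = 1"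
      "\<And>g h. g \<in> carrier G \<Longrightarrow> h \<in> carrier G \<Longrightarrow> \<alpha> g (p h) = p (g \<otimes>\<^bsub>G\<^esub> h)"
      "\<And>h. h \<in> carrier G \<Longrightarrow> norm (p h - e h) \<le> 25 * N * \<delta>"
      using Rokhlin_projections_equivariant[OF assms(2-4) e(1,2) less_imp_le[OF e(3)]] \<delta>(1)
      unfolding N_def by blast
    have "norm (p g * a - a * p g) < \<epsilon>" if g: "g \<in> carrier G" and a: "a \<in> F" for g a
    proof -
      have "p g * a - a * p g = (e g * a - a * e g) + ((p g - e g) * a - a * (p g - e g))"
        by (simp add: algebra_simps)
      \<comment> \<open>Strictness comes from the commutator with \<open>e g\<close>; the
        replacement errors are bounded only weakly.\<close>
      also have "norm \<dots> < \<delta> + (25 * N * \<delta> * M + M * (25 * N * \<delta>))"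
      proof (intro order_le_less_trans[OF norm_triangle_ineq] add_less_le_mono e(4) g a
          order_trans[OF norm_triangle_ineq4] add_mono)
        show "norm ((p g - e g) * a) \<le> 25 * N * \<delta> * M"
          using N0 \<delta>0 by (intro order_trans[OF norm_mult_ineq] mult_mono p(4) M g a) auto
        show "norm (a * (p g - e g)) \<le> M * (25 * N * \<delta>)"
          using M0 by (intro order_trans[OF norm_mult_ineq] mult_mono p(4) M g a) auto
      qed
      also have "\<dots> \<le> \<epsilon>"
        using \<delta>(2) by (simp add: algebra_simps)
      finally show ?thesis .
    qed
    with p show "\<exists>e. orthogonal_projections (carrier G) e \<and>
        (\<forall>g\<in>carrier G. \<forall>h\<in>carrier G. \<alpha> g (e h) = e (g \<otimes>\<^bsub>G\<^esub> h)) \<and>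
        (\<forall>g\<in>carrier G. \<forall>a\<in>F. norm (e g * a - a * e g) < \<epsilon>) \<and>
        (\<Sum>g\<in>carrier G. e g) = 1"
      by blast
  qed
next
  assume exact: ?exact
  show "Rokhlin_property G \<alpha>"
    unfolding Rokhlin_property_def
  proof (intro allI impI)
    fix F :: "'a set" and \<epsilon> :: real
    assume "finite F" "\<epsilon> > 0"
    with exact obtain e where "orthogonal_projections (carrier G) e"
      "\<forall>g\<in>carrier G. \<forall>h\<in>carrier G. \<alpha> g (e h) = e (g \<otimes>\<^bsub>G\<^esub> h)"
      "\<forall>g\<in>carrier G. \<forall>a\<in>F. norm (e g * a - a * e g) < \<epsilon>" "sum e (carrier G) = 1"
      by metis
    with \<open>\<epsilon> > 0\<close> show "\<exists>e. orthogonal_projections (carrier G) e \<and>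
        (\<forall>g\<in>carrier G. \<forall>h\<in>carrier G. norm (\<alpha> g (e h) - e (g \<otimes>\<^bsub>G\<^esub> h)) < \<epsilon>) \<and>
        (\<forall>g\<in>carrier G. \<forall>a\<in>F. norm (e g * a - a * e g) < \<epsilon>) \<and>
        (\<Sum>g\<in>carrier G. e g) = 1"
      by (intro exI[of _ e]) simp
  qed
qed

end
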